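(* Let $G$ be a finite group acting transitively on a set $\Omega$, and suppose that $G$ has a normal subgroup that acts regularly on $\Omega$. Then the action of $G$ on $\Omega$ satisfies the EKR-module property.
   Context: Let $G$ be a finite group acting transitively on a set $\Omega$. Elements $\sigma,\tau\in G$ intersect if $\sigma\tau^{-1}$ fixes a point of $\Omega$; a subset of $G$ is an intersecting set if any two of its elements intersect; a maximum intersecting set is an intersecting set of maximum possible size. For $S\subseteq G$, $\mathbf{v}_S=\sum_{s\in S}s\in\mathbb{C}G$ is its characteristic vector in the group algebra. The canonical vectors are $\mathbf{v}_{\alpha,\beta}=\sum_{t\in G,\ t\cdot\alpha=\beta}t$ for $\alpha,\beta\in\Omega$. The action of $G$ on $\Omega$ satisfies the EKR-module property if the characteristic vector of each maximum intersecting set is a $\mathbb{C}$-linear combination of canonical vectors. *)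

theory Defs
  imports "HOL-Algebra.Group_Action" "HOL-Library.Poly_Mapping" Complex_Main
begin

locale regular_action = transitive_action +
  assumes trivial_stabilizer: "x \<in> E \<Longrightarrow> stabilizer G \<phi> x = {\<one>}"

definition intersect ::
    "('a, 'm) monoid_scheme \<Rightarrow> 'b set \<Rightarrow> ('a \<Rightarrow> 'b \<Rightarrow> 'b) \<Rightarrow> 'a \<Rightarrow> 'a \<Rightarrow> bool" where
  "intersect G E \<phi> \<sigma> \<tau> \<longleftrightarrow> (\<exists>x\<in>E. \<phi> (\<sigma> \<otimes>\<^bsub>G\<^esub> inv\<^bsub>G\<^esub> \<tau>) x = x)"

definition intersecting_set ::
    "('a, 'm) monoid_scheme \<Rightarrow> 'b set \<Rightarrow> ('a \<Rightarrow> 'b \<Rightarrow> 'b) \<Rightarrow> 'a set \<Rightarrow> bool" where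
  "intersecting_set G E \<phi> S \<longleftrightarrow>
     S \<subseteq> carrier G \<and> (\<forall>\<sigma>\<in>S. \<forall>\<tau>\<in>S. intersect G E \<phi> \<sigma> \<tau>)"

(* card is the true size here only because the group is assumed to be finite. *)
definition maximum_intersecting_set ::
    "('a, 'm) monoid_scheme \<Rightarrow> 'b set \<Rightarrow> ('a \<Rightarrow> 'b \<Rightarrow> 'b) \<Rightarrow> 'a set \<Rightarrow> bool" where
  "maximum_intersecting_set G E \<phi> S \<longleftrightarrow>
     intersecting_set G E \<phi> S \<and> (\<forall>T. intersecting_set G E \<phi> T \<longrightarrow> card T \<le> card S)"

(* The underlying vector space of the group algebra: formal complex combinations of elements
   of 'a. The group algebra of G is the subspace of those supported on carrier G, and it contains
   all vectors formed below. Only its linear structure is used; the convolution product that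
   Poly_Mapping defines from an additive monoid on 'a plays no role. *)
type_synonym 'a group_algebra = "'a \<Rightarrow>\<^sub>0 complex"

definition scale :: "complex \<Rightarrow> 'a group_algebra \<Rightarrow> 'a group_algebra" where
  "scale c v = Poly_Mapping.map ((*) c) v"

lemma lookup_scale: "Poly_Mapping.lookup (scale c v) g = c * Poly_Mapping.lookup v g"
  by (simp add: scale_def Poly_Mapping.map.rep_eq when_def)

interpretation group_algebra: vector_space scale
  by unfold_locales (simp_all add: poly_mapping_eq_iff fun_eq_iff lookup_scale lookup_add
    distrib_left distrib_right)

definition char_vec :: "'a set \<Rightarrow> 'a group_algebra" where
  "char_vec S = (\<Sum>s\<in>S. Poly_Mapping.single s 1)"

definition canonical_vec ::
    "('a, 'm) monoid_scheme \<Rightarrow> ('a \<Rightarrow> 'b \<Rightarrow> 'b) \<Rightarrow> 'b \<Rightarrow> 'b \<Rightarrow> 'a group_algebra" where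
  "canonical_vec G \<phi> \<alpha> \<beta> = (\<Sum>t\<in>{t \<in> carrier G. \<phi> t \<alpha> = \<beta>}. Poly_Mapping.single t 1)"

definition EKR_module_property ::
    "('a, 'm) monoid_scheme \<Rightarrow> 'b set \<Rightarrow> ('a \<Rightarrow> 'b \<Rightarrow> 'b) \<Rightarrow> bool" where
  "EKR_module_property G E \<phi> \<longleftrightarrow>
     (\<forall>S. maximum_intersecting_set G E \<phi> S \<longrightarrow>
        char_vec S \<in> group_algebra.span {canonical_vec G \<phi> \<alpha> \<beta> | \<alpha> \<beta>. \<alpha> \<in> E \<and> \<beta> \<in> E})"

end

theory Submission
  imports Defs
begin

text \<open>
  Write \<open>H\<close> for a point stabilizer, \<open>M\<close> for the span of the canonical vectors and \<open>v\<^sub>S\<close> for the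
  characteristic vector of \<open>S\<close>. Two facts about a maximum intersecting set \<open>S\<close> combine.

  The first is combinatorial. By regularity every \<open>g\<close> is uniquely \<open>n \<otimes> \<pi> g\<close> with \<open>n \<in> N\<close> and
  \<open>\<pi> g \<in> H\<close>. Two elements of \<open>S\<close> in the same coset of \<open>N\<close> have a quotient in \<open>N\<close> with a fixed
  point, so they are equal; and \<open>H\<close> is itself intersecting, so \<open>card H \<le> card S\<close>. Hence \<open>\<pi>\<close> is a
  bijection from \<open>S\<close> to \<open>H\<close>. Moreover \<open>s \<otimes> inv t\<close>, which fixes a point, is conjugate under \<open>N\<close> to
  an element of \<open>H\<close>, and this element is \<open>\<pi> s \<otimes> inv (\<pi> t)\<close> because \<open>H\<close> meets each coset
  of \<open>N\<close> once. So for every class function \<open>r\<close>, the sum of \<open>r (s \<otimes> inv t)\<close> over \<open>s, t \<in> S\<close> is the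
  same as for \<open>H\<close> in place of \<open>S\<close> (\<open>sum_class_fun_eq_stabilizer\<close>).

  The second is that \<open>M\<close> is a two-sided ideal, so its orthogonal complement is cut out by a class
  function: let \<open>r\<close> be the component of the identity element orthogonal to \<open>M\<close>. It is invariant
  under conjugation since \<open>M\<close> is, and the component of \<open>v\<^sub>S\<close> orthogonal to \<open>M\<close> is
  \<open>w g = (\<Sum>s\<in>S. r (g \<otimes> inv s))\<close>. Its squared norm is its inner product with \<open>v\<^sub>S\<close>, namely the sum
  of \<open>r (s \<otimes> inv t)\<close> over \<open>s, t \<in> S\<close>. By the first fact this equals the squared norm for \<open>H\<close>, which
  vanishes because \<open>v\<^sub>H\<close> is a canonical vector. So \<open>w = 0\<close>, that is, \<open>v\<^sub>S \<in> M\<close>.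

  Elements of the group algebra are treated as functions on the group, and \<open>M\<close> as the space of
  functions \<open>g \<mapsto> (\<Sum>\<alpha>\<in>E. c \<alpha> (\<phi> g \<alpha>))\<close>, on which the translations act by changing \<open>c\<close>.
\<close>

section \<open>Orthogonal components in finite-dimensional function spaces\<close>

definition hip :: "'a set \<Rightarrow> ('a \<Rightarrow> complex) \<Rightarrow> ('a \<Rightarrow> complex) \<Rightarrow> complex" where
  "hip X f h = (\<Sum>g\<in>X. f g * cnj (h g))"

lemma hip_diff_left: "hip X (\<lambda>g. f g - f' g) h = hip X f h - hip X f' h"
  by (simp add: hip_def left_diff_distrib sum_subtractf)

lemma hip_diff_right: "hip X f (\<lambda>g. h g - h' g) = hip X f h - hip X f h'"
  by (simp add: hip_def right_diff_distrib sum_subtractf)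

lemma hip_add_right: "hip X f (\<lambda>g. h g + h' g) = hip X f h + hip X f h'"
  by (simp add: hip_def distrib_left sum.distrib)

lemma hip_scale_left: "hip X (\<lambda>g. c * f g) h = c * hip X f h"
  by (simp add: hip_def sum_distrib_left mult.assoc)

lemma hip_scale_right: "hip X f (\<lambda>g. c * h g) = cnj c * hip X f h"
  by (simp add: hip_def sum_distrib_left mult_ac)

lemma hip_sum_left: "hip X (\<lambda>g. \<Sum>i\<in>I. f i g) h = (\<Sum>i\<in>I. hip X (f i) h)"
  unfolding hip_def sum_distrib_right by (rule sum.swap)

lemma hip_sum_right: "hip X f (\<lambda>g. \<Sum>i\<in>I. h i g) = (\<Sum>i\<in>I. hip X f (h i))"
  unfolding hip_def cnj_sum sum_distrib_left by (rule sum.swap)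

lemma hip_cong:
  "(\<And>g. g \<in> X \<Longrightarrow> f g = f' g) \<Longrightarrow> (\<And>g. g \<in> X \<Longrightarrow> h g = h' g) \<Longrightarrow> hip X f h = hip X f' h'"
  by (simp add: hip_def)

lemma hip_self_eq_0:
  assumes "finite X" "hip X f f = 0" "g \<in> X"
  shows "f g = 0"
proof -
  have "hip X f f = of_real (\<Sum>g\<in>X. (cmod (f g))\<^sup>2)"
    by (simp add: hip_def complex_norm_square del: of_real_power)
  with assms(2) have "(\<Sum>g\<in>X. (cmod (f g))\<^sup>2) = 0"
    by (metis of_real_eq_0_iff)
  with assms(1,3) show ?thesis
    by (simp add: sum_nonneg_eq_0_iff)
qed

text \<open>One step of Gram--Schmidt orthogonalization for each member of the family \<open>u\<close>.\<close>

lemma orthogonal_component_exists: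
  fixes u :: "'i \<Rightarrow> 'a \<Rightarrow> complex"
  assumes "finite X" "finite I"
  shows "\<exists>c. \<forall>j\<in>I. hip X (\<lambda>g. v g - (\<Sum>i\<in>I. c i * u i g)) (u j) = 0"
  using assms(2)
proof (induction I arbitrary: v rule: finite_induct)
  case empty
  show ?case by simp
next
  case (insert k I)
  obtain a where a: "\<And>j. j \<in> I \<Longrightarrow> hip X (\<lambda>g. v g - (\<Sum>i\<in>I. a i * u i g)) (u j) = 0"
    using insert.IH by blast
  obtain b where b: "\<And>j. j \<in> I \<Longrightarrow> hip X (\<lambda>g. u k g - (\<Sum>i\<in>I. b i * u i g)) (u j) = 0"
    using insert.IH by blast
  define v' where "v' = (\<lambda>g. v g - (\<Sum>i\<in>I. a i * u i g))"
  define u' where "u' = (\<lambda>g. u k g - (\<Sum>i\<in>I. b i * u i g))"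
  \<comment> \<open>If \<open>u k\<close> depends on the earlier vectors then \<open>u'\<close> vanishes on \<open>X\<close>, and \<open>t = 0\<close> by the
      convention on division by zero.\<close>
  define t where "t = hip X v' u' / hip X u' u'"
  define w where "w = (\<lambda>g. v' g - t * u' g)"
  define c where "c = (\<lambda>i. if i = k then t else a i - t * b i)"
  have w_eq: "v g - (\<Sum>i\<in>insert k I. c i * u i g) = w g" for g
  proof -
    have "(\<Sum>i\<in>I. c i * u i g) = (\<Sum>i\<in>I. a i * u i g - t * (b i * u i g))"
      using insert.hyps by (intro sum.cong) (auto simp: c_def algebra_simps)
    also have "\<dots> = (\<Sum>i\<in>I. a i * u i g) - t * (\<Sum>i\<in>I. b i * u i g)"
      by (simp add: sum_subtractf sum_distrib_left)
    finally show ?thesis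
      using insert.hyps by (simp add: w_def v'_def u'_def c_def algebra_simps)
  qed
  have w_I: "hip X w (u j) = 0" if "j \<in> I" for j
  proof -
    have "hip X v' (u j) = 0" "hip X u' (u j) = 0"
      using a[OF that] b[OF that] by (simp_all add: v'_def u'_def)
    then show ?thesis by (simp add: w_def hip_diff_left hip_scale_left)
  qed
  have w_u': "hip X w u' = 0"
  proof (cases "hip X u' u' = 0")
    case True
    have "u' g = 0" if "g \<in> X" for g
      using hip_self_eq_0[OF assms(1) True that] .
    then show ?thesis by (simp add: hip_def)
  next
    case False
    then have "t * hip X u' u' = hip X v' u'" by (simp add: t_def)
    then show ?thesis unfolding w_def hip_diff_left hip_scale_left by simp
  qed
  have "hip X w (u k) = hip X w (\<lambda>g. u' g + (\<Sum>i\<in>I. b i * u i g))"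
    by (simp add: u'_def)
  also have "\<dots> = 0"
    unfolding hip_add_right hip_sum_right hip_scale_right by (simp add: w_u' w_I)
  finally have "hip X w (u k) = 0" .
  with w_I have "\<forall>j\<in>insert k I. hip X w (u j) = 0" by simp
  then show ?case
    unfolding w_eq[symmetric] by blast
qed

section \<open>The two-sided ideal spanned by the canonical vectors\<close>

text \<open>For finite \<open>E\<close> these are the functions that agree on the group with a combination of canonical
  ones. Leaving \<open>c\<close> an arbitrary function of two points makes invariance under both translations
  a change of variable: on the right in the first argument, on the left in the second.\<close>

definition point_image_fun ::
    "('a, 'm) monoid_scheme \<Rightarrow> 'b set \<Rightarrow> ('a \<Rightarrow> 'b \<Rightarrow> 'b) \<Rightarrow> ('a \<Rightarrow> complex) \<Rightarrow> bool" where
  "point_image_fun G E \<phi> f \<longleftrightarrow> (\<exists>c. \<forall>g\<in>carrier G. f g = (\<Sum>\<alpha>\<in>E. c \<alpha> (\<phi> g \<alpha>)))"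

lemma point_image_fun_cong:
  "(\<And>g. g \<in> carrier G \<Longrightarrow> f g = f' g) \<Longrightarrow> point_image_fun G E \<phi> f = point_image_fun G E \<phi> f'"
  by (simp add: point_image_fun_def)

lemma point_image_fun_zero: "point_image_fun G E \<phi> (\<lambda>g. 0)"
  unfolding point_image_fun_def by (rule exI[of _ "\<lambda>_ _. 0"]) simp

lemma point_image_fun_add:
  assumes "point_image_fun G E \<phi> f" "point_image_fun G E \<phi> h"
  shows "point_image_fun G E \<phi> (\<lambda>g. f g + h g)"
proof -
  obtain c d where "\<forall>g\<in>carrier G. f g = (\<Sum>\<alpha>\<in>E. c \<alpha> (\<phi> g \<alpha>))"
    "\<forall>g\<in>carrier G. h g = (\<Sum>\<alpha>\<in>E. d \<alpha> (\<phi> g \<alpha>))"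
    using assms unfolding point_image_fun_def by blast
  then show ?thesis
    unfolding point_image_fun_def
    by (intro exI[of _ "\<lambda>\<alpha> \<beta>. c \<alpha> \<beta> + d \<alpha> \<beta>"]) (simp add: sum.distrib)
qed

lemma point_image_fun_scale:
  assumes "point_image_fun G E \<phi> f"
  shows "point_image_fun G E \<phi> (\<lambda>g. a * f g)"
proof -
  obtain c where "\<forall>g\<in>carrier G. f g = (\<Sum>\<alpha>\<in>E. c \<alpha> (\<phi> g \<alpha>))"
    using assms unfolding point_image_fun_def by blast
  then show ?thesis
    unfolding point_image_fun_def
    by (intro exI[of _ "\<lambda>\<alpha> \<beta>. a * c \<alpha> \<beta>"]) (simp add: sum_distrib_left)
qed

lemma point_image_fun_diff:
  assumes "point_image_fun G E \<phi> f" "point_image_fun G E \<phi> h"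
  shows "point_image_fun G E \<phi> (\<lambda>g. f g - h g)"
  using point_image_fun_add[OF assms(1) point_image_fun_scale[OF assms(2), of "-1"]] by simp

lemma point_image_fun_sum:
  assumes "\<And>i. i \<in> I \<Longrightarrow> point_image_fun G E \<phi> (f i)"
  shows "point_image_fun G E \<phi> (\<lambda>g. \<Sum>i\<in>I. f i g)"
  using assms
  by (induction I rule: infinite_finite_induct)
    (simp_all add: point_image_fun_zero point_image_fun_add)

lemma point_image_fun_canonical:
  assumes "finite E" "\<alpha> \<in> E"
  shows "point_image_fun G E \<phi> (\<lambda>g. of_bool (\<phi> g \<alpha> = \<beta>))"
  unfolding point_image_fun_def
proof (intro exI ballI)
  fix g
  have "(\<Sum>\<alpha>'\<in>E. of_bool (\<alpha>' = \<alpha> \<and> \<phi> g \<alpha>' = \<beta>))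
      = (\<Sum>\<alpha>'\<in>E. if \<alpha>' = \<alpha> then of_bool (\<phi> g \<alpha> = \<beta>) else 0 :: complex)"
    by (intro sum.cong) auto
  with assms show "of_bool (\<phi> g \<alpha> = \<beta>)
      = (\<Sum>\<alpha>'\<in>E. (\<lambda>a b. of_bool (a = \<alpha> \<and> b = \<beta>) :: complex) \<alpha>' (\<phi> g \<alpha>'))"
    by simp
qed

text \<open>The sum over \<open>E\<close> splits according to the value of \<open>\<phi> g \<alpha>\<close>, which for \<open>g\<close> in the group is again
  a point of \<open>E\<close>; this is how a function of the above form becomes a combination of the canonical
  functions.\<close>

lemma (in group_action) point_image_fun_expand:
  assumes "finite E" "point_image_fun G E \<phi> f"
  obtains c where
    "\<And>g. g \<in> carrier G \<Longrightarrow> f g = (\<Sum>(\<alpha>,\<beta>)\<in>E \<times> E. c \<alpha> \<beta> * of_bool (\<phi> g \<alpha> = \<beta>))"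
proof -
  obtain c where c: "\<And>g. g \<in> carrier G \<Longrightarrow> f g = (\<Sum>\<alpha>\<in>E. c \<alpha> (\<phi> g \<alpha>))"
    using assms(2) unfolding point_image_fun_def by blast
  have "f g = (\<Sum>(\<alpha>,\<beta>)\<in>E \<times> E. c \<alpha> \<beta> * of_bool (\<phi> g \<alpha> = \<beta>))" if g: "g \<in> carrier G" for g
  proof -
    have "(\<Sum>\<beta>\<in>E. c \<alpha> \<beta> * of_bool (\<phi> g \<alpha> = \<beta>)) = c \<alpha> (\<phi> g \<alpha>)" if "\<alpha> \<in> E" for \<alpha>
    proof -
      have "(\<Sum>\<beta>\<in>E. c \<alpha> \<beta> * of_bool (\<phi> g \<alpha> = \<beta>))
          = (\<Sum>\<beta>\<in>E. if \<beta> = \<phi> g \<alpha> then c \<alpha> (\<phi> g \<alpha>) else 0)"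
        by (intro sum.cong) auto
      then show ?thesis
        using assms(1) element_image[OF g that refl] by simp
    qed
    then show ?thesis
      by (simp add: c[OF g] sum.cartesian_product[symmetric])
  qed
  then show ?thesis by (rule that)
qed

lemma (in group_action) point_image_fun_right_translate:
  assumes "point_image_fun G E \<phi> f" and s: "s \<in> carrier G"
  shows "point_image_fun G E \<phi> (\<lambda>g. f (g \<otimes> s))"
proof -
  interpret group G using group_hom group_hom.axioms(1) by auto
  obtain c where c: "\<And>g. g \<in> carrier G \<Longrightarrow> f g = (\<Sum>\<alpha>\<in>E. c \<alpha> (\<phi> g \<alpha>))"
    using assms(1) unfolding point_image_fun_def by blast
  have bij: "bij_betw (\<phi> s) E E"
    using bij_prop0[OF s] by (simp add: Bij_def)
  have "f (g \<otimes> s) = (\<Sum>\<alpha>\<in>E. c (inv_into E (\<phi> s) \<alpha>) (\<phi> g \<alpha>))" if g: "g \<in> carrier G" for g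
  proof -
    have "f (g \<otimes> s) = (\<Sum>\<alpha>\<in>E. c \<alpha> (\<phi> g (\<phi> s \<alpha>)))"
      using g s by (simp add: c composition_rule)
    also have "\<dots> = (\<Sum>\<alpha>\<in>E. c (inv_into E (\<phi> s) (\<phi> s \<alpha>)) (\<phi> g (\<phi> s \<alpha>)))"
      using bij by (intro sum.cong refl) (simp add: bij_betw_inv_into_left)
    also have "\<dots> = (\<Sum>\<alpha>\<in>E. c (inv_into E (\<phi> s) \<alpha>) (\<phi> g \<alpha>))"
      by (rule sum.reindex_bij_betw[OF bij])
    finally show ?thesis .
  qed
  then show ?thesis
    unfolding point_image_fun_def by (intro exI[of _ "\<lambda>\<alpha>. c (inv_into E (\<phi> s) \<alpha>)"]) blast
qed

lemma (in group_action) point_image_fun_left_translate: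
  assumes "point_image_fun G E \<phi> f" and s: "s \<in> carrier G"
  shows "point_image_fun G E \<phi> (\<lambda>g. f (s \<otimes> g))"
proof -
  interpret group G using group_hom group_hom.axioms(1) by auto
  obtain c where c: "\<And>g. g \<in> carrier G \<Longrightarrow> f g = (\<Sum>\<alpha>\<in>E. c \<alpha> (\<phi> g \<alpha>))"
    using assms(1) unfolding point_image_fun_def by blast
  have "f (s \<otimes> g) = (\<Sum>\<alpha>\<in>E. c \<alpha> (\<phi> s (\<phi> g \<alpha>)))" if "g \<in> carrier G" for g
    using that s by (simp add: c composition_rule)
  then show ?thesis
    unfolding point_image_fun_def by (intro exI[of _ "\<lambda>\<alpha> \<beta>. c \<alpha> (\<phi> s \<beta>)"]) blast
qed

lemma (in group) hip_right_translate:
  assumes s: "s \<in> carrier G"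
  shows "hip (carrier G) (\<lambda>g. f (g \<otimes> s)) h = hip (carrier G) f (\<lambda>g. h (g \<otimes> inv s))"
proof -
  have bij: "bij_betw (\<lambda>g. g \<otimes> s) (carrier G) (carrier G)"
    by (rule bij_betwI[where g = "\<lambda>g. g \<otimes> inv s"]) (use s in \<open>auto simp: m_assoc\<close>)
  have "hip (carrier G) f (\<lambda>g. h (g \<otimes> inv s))
      = (\<Sum>g\<in>carrier G. f (g \<otimes> s) * cnj (h (g \<otimes> s \<otimes> inv s)))"
    unfolding hip_def by (rule sum.reindex_bij_betw[OF bij, symmetric])
  also have "\<dots> = hip (carrier G) (\<lambda>g. f (g \<otimes> s)) h"
    unfolding hip_def using s by (intro sum.cong) (auto simp: m_assoc)
  finally show ?thesis by simp
qed

lemma (in group) hip_left_translate: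
  assumes s: "s \<in> carrier G"
  shows "hip (carrier G) (\<lambda>g. f (s \<otimes> g)) h = hip (carrier G) f (\<lambda>g. h (inv s \<otimes> g))"
proof -
  have bij: "bij_betw (\<lambda>g. s \<otimes> g) (carrier G) (carrier G)"
    by (rule bij_betwI[where g = "\<lambda>g. inv s \<otimes> g"]) (use s in \<open>auto simp: m_assoc[symmetric]\<close>)
  have "hip (carrier G) f (\<lambda>g. h (inv s \<otimes> g))
      = (\<Sum>g\<in>carrier G. f (s \<otimes> g) * cnj (h (inv s \<otimes> (s \<otimes> g))))"
    unfolding hip_def by (rule sum.reindex_bij_betw[OF bij, symmetric])
  also have "\<dots> = hip (carrier G) (\<lambda>g. f (s \<otimes> g)) h"
    unfolding hip_def using s by (intro sum.cong) (auto simp: m_assoc[symmetric])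
  finally show ?thesis by simp
qed

text \<open>The component of the identity element orthogonal to the ideal is a class function because
  conjugating it gives another such component, and the component is unique.\<close>

lemma (in group_action) orthogonal_class_function_exists:
  assumes finG: "finite (carrier G)" and finE: "finite E"
  obtains r :: "'a \<Rightarrow> complex" where
    "point_image_fun G E \<phi> (\<lambda>g. of_bool (g = \<one>) - r g)"
    "\<And>f. point_image_fun G E \<phi> f \<Longrightarrow> hip (carrier G) r f = 0"
    "\<And>x g. x \<in> carrier G \<Longrightarrow> g \<in> carrier G \<Longrightarrow> r (inv x \<otimes> g \<otimes> x) = r g"
proof -
  interpret group G using group_hom group_hom.axioms(1) by auto
  let ?X = "carrier G"
  define u where "u = (\<lambda>(\<alpha>,\<beta>) g. of_bool (\<phi> g \<alpha> = \<beta>) :: complex)"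
  obtain c where c: "\<And>j. j \<in> E \<times> E \<Longrightarrow>
      hip ?X (\<lambda>g. of_bool (g = \<one>) - (\<Sum>i\<in>E \<times> E. c i * u i g)) (u j) = 0"
    using orthogonal_component_exists[of ?X "E \<times> E" "\<lambda>g. of_bool (g = \<one>)" u] finG finE
    by blast
  define r where "r = (\<lambda>g. of_bool (g = \<one>) - (\<Sum>i\<in>E \<times> E. c i * u i g))"
  have "point_image_fun G E \<phi> (\<lambda>g. \<Sum>i\<in>E \<times> E. c i * u i g)"
    using finE by (intro point_image_fun_sum point_image_fun_scale)
      (auto simp: u_def intro: point_image_fun_canonical)
  then have in_ideal: "point_image_fun G E \<phi> (\<lambda>g. of_bool (g = \<one>) - r g)"
    by (simp add: r_def)
  have orth: "hip ?X r f = 0" if f: "point_image_fun G E \<phi> f" for f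
  proof -
    obtain d where d: "\<And>g. g \<in> ?X \<Longrightarrow> f g = (\<Sum>(\<alpha>,\<beta>)\<in>E \<times> E. d \<alpha> \<beta> * of_bool (\<phi> g \<alpha> = \<beta>))"
      using point_image_fun_expand[OF finE f] by blast
    have "hip ?X r f = hip ?X r (\<lambda>g. \<Sum>j\<in>E \<times> E. (case j of (\<alpha>,\<beta>) \<Rightarrow> d \<alpha> \<beta>) * u j g)"
      by (rule hip_cong) (simp_all add: d u_def case_prod_beta)
    also have "\<dots> = 0"
      unfolding hip_sum_right hip_scale_right using c by (auto simp: r_def intro!: sum.neutral)
    finally show ?thesis .
  qed
  have invariant: "r (inv x \<otimes> g \<otimes> x) = r g" if x: "x \<in> ?X" and g: "g \<in> ?X" for x g
  proof -
    define q where "q = (\<lambda>g. r (inv x \<otimes> g \<otimes> x))"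
    have "point_image_fun G E \<phi> (\<lambda>g. of_bool (inv x \<otimes> g \<otimes> x = \<one>) - q g)"
      using point_image_fun_left_translate[OF
        point_image_fun_right_translate[OF in_ideal x] inv_closed[OF x]]
      by (simp add: q_def)
    moreover have "inv x \<otimes> g \<otimes> x = \<one> \<longleftrightarrow> g = \<one>" if "g \<in> ?X" for g
      using x that by (metis inv_closed inv_inv inv_equality l_inv m_closed r_one inv_solve_left)
    ultimately have "point_image_fun G E \<phi> (\<lambda>g. of_bool (g = \<one>) - q g)"
      by (subst point_image_fun_cong[where f' = "\<lambda>g. of_bool (inv x \<otimes> g \<otimes> x = \<one>) - q g"]) auto
    from point_image_fun_diff[OF in_ideal this]
    have diff: "point_image_fun G E \<phi> (\<lambda>g. q g - r g)" by simp
    have "hip ?X q f = 0" if f: "point_image_fun G E \<phi> f" for f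
    proof -
      have "hip ?X q f = hip ?X (\<lambda>g. r (g \<otimes> x)) (\<lambda>g. f (inv (inv x) \<otimes> g))"
        unfolding q_def using hip_left_translate[of "inv x" "\<lambda>g. r (g \<otimes> x)" f] x by simp
      also have "\<dots> = hip ?X r (\<lambda>g. f (inv (inv x) \<otimes> (g \<otimes> inv x)))"
        using hip_right_translate[of x r] x by simp
      also have "\<dots> = 0"
        by (rule orth, rule point_image_fun_right_translate[where f = "\<lambda>g. f (inv (inv x) \<otimes> g)"])
          (use point_image_fun_left_translate[OF f] x in auto)
      finally show ?thesis .
    qed
    with diff have "hip ?X (\<lambda>g. q g - r g) (\<lambda>g. q g - r g) = 0"
      by (simp add: hip_diff_left orth)
    from hip_self_eq_0[OF finG this g] show ?thesis by (simp add: q_def)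
  qed
  from in_ideal orth invariant show ?thesis by (rule that)
qed

text \<open>The double sum is the squared norm of the component \<open>w\<close> of the indicator function of \<open>S\<close>
  orthogonal to the ideal: \<open>w\<close> is the sum of the translates of \<open>r\<close> by the elements of \<open>S\<close>, and
  its inner product with itself equals that with the indicator function.\<close>

lemma (in group_action) indicator_mem_ideal_iff:
  fixes r :: "'a \<Rightarrow> complex"
  assumes finG: "finite (carrier G)"
    and in_ideal: "point_image_fun G E \<phi> (\<lambda>g. of_bool (g = \<one>) - r g)"
    and orth: "\<And>f. point_image_fun G E \<phi> f \<Longrightarrow> hip (carrier G) r f = 0"
    and S: "S \<subseteq> carrier G"
  shows "point_image_fun G E \<phi> (\<lambda>g. of_bool (g \<in> S)) \<longleftrightarrow>
    (\<Sum>t\<in>S. \<Sum>s\<in>S. r (t \<otimes> inv s)) = 0"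
proof -
  interpret group G using group_hom group_hom.axioms(1) by auto
  let ?X = "carrier G"
  define w where "w = (\<lambda>g. \<Sum>s\<in>S. r (g \<otimes> inv s))"
  have finS: "finite S" using finG S by (rule rev_finite_subset)
  have w_orth: "hip ?X w f = 0" if f: "point_image_fun G E \<phi> f" for f
  proof -
    have "hip ?X (\<lambda>g. r (g \<otimes> inv s)) f = 0" if "s \<in> S" for s
      using that S hip_right_translate[of "inv s" r f]
        orth[OF point_image_fun_right_translate[OF f, of "inv (inv s)"]] by auto
    then show ?thesis unfolding w_def hip_sum_left by simp
  qed
  have "point_image_fun G E \<phi> (\<lambda>g. \<Sum>s\<in>S. of_bool (g \<otimes> inv s = \<one>) - r (g \<otimes> inv s))"
    using S by (intro point_image_fun_sum point_image_fun_right_translate[OF in_ideal]) auto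
  moreover have "(\<Sum>s\<in>S. of_bool (g \<otimes> inv s = \<one>) - r (g \<otimes> inv s)) = of_bool (g \<in> S) - w g"
    if g: "g \<in> ?X" for g
  proof -
    have "g \<otimes> inv s = \<one> \<longleftrightarrow> s = g" if "s \<in> S" for s
      using that S g by (metis inv_closed inv_inv inv_equality r_inv subsetD)
    then have "(\<Sum>s\<in>S. of_bool (g \<otimes> inv s = \<one>)) = (\<Sum>s\<in>S. if s = g then 1 else 0 :: complex)"
      by (intro sum.cong) auto
    then show ?thesis using finS by (simp add: sum_subtractf w_def)
  qed
  ultimately have v_minus_w: "point_image_fun G E \<phi> (\<lambda>g. of_bool (g \<in> S) - w g)"
    by (subst point_image_fun_cong[where
        f' = "\<lambda>g. \<Sum>s\<in>S. of_bool (g \<otimes> inv s = \<one>) - r (g \<otimes> inv s)"]) simp_all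
  have "hip ?X w (\<lambda>g. of_bool (g \<in> S)) = (\<Sum>t\<in>S. w t)"
  proof -
    have "hip ?X w (\<lambda>g. of_bool (g \<in> S)) = (\<Sum>g\<in>?X. if g \<in> S then w g else 0)"
      unfolding hip_def by (intro sum.cong) auto
    also have "\<dots> = sum w S"
      using finG S by (simp add: sum.inter_restrict[symmetric] Int_absorb1)
    finally show ?thesis .
  qed
  then have norm: "hip ?X w (\<lambda>g. of_bool (g \<in> S)) = (\<Sum>t\<in>S. \<Sum>s\<in>S. r (t \<otimes> inv s))"
    by (simp add: w_def)
  show ?thesis
  proof
    assume "point_image_fun G E \<phi> (\<lambda>g. of_bool (g \<in> S))"
    from w_orth[OF this] show "(\<Sum>t\<in>S. \<Sum>s\<in>S. r (t \<otimes> inv s)) = 0"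
      using norm by simp
  next
    assume "(\<Sum>t\<in>S. \<Sum>s\<in>S. r (t \<otimes> inv s)) = 0"
    with norm w_orth[OF v_minus_w] have "hip ?X w w = 0"
      by (simp add: hip_diff_right)
    then have "w g = 0" if "g \<in> ?X" for g
      using hip_self_eq_0[OF finG _ that] by blast
    then show "point_image_fun G E \<phi> (\<lambda>g. of_bool (g \<in> S))"
      using v_minus_w by (subst point_image_fun_cong[where f' = "\<lambda>g. of_bool (g \<in> S) - w g"]) simp_all
  qed
qed

lemma lookup_sum_single:
  "finite S \<Longrightarrow> Poly_Mapping.lookup (\<Sum>s\<in>S. Poly_Mapping.single s (1::complex)) g = of_bool (g \<in> S)"
  by (induction S rule: finite_induct) (auto simp: lookup_add lookup_single when_def)

lemma (in group_action) char_vec_in_span_canonical: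
  assumes finG: "finite (carrier G)" and finE: "finite E" and S: "S \<subseteq> carrier G"
    and ideal: "point_image_fun G E \<phi> (\<lambda>g. of_bool (g \<in> S))"
  shows "char_vec S \<in> group_algebra.span {canonical_vec G \<phi> \<alpha> \<beta> | \<alpha> \<beta>. \<alpha> \<in> E \<and> \<beta> \<in> E}"
proof -
  obtain c where c: "\<And>g. g \<in> carrier G \<Longrightarrow>
      (of_bool (g \<in> S) :: complex) = (\<Sum>(\<alpha>,\<beta>)\<in>E \<times> E. c \<alpha> \<beta> * of_bool (\<phi> g \<alpha> = \<beta>))"
    using point_image_fun_expand[OF finE ideal] by blast
  have finS: "finite S" using finG S by (rule rev_finite_subset)
  have "char_vec S = (\<Sum>(\<alpha>,\<beta>)\<in>E \<times> E. scale (c \<alpha> \<beta>) (canonical_vec G \<phi> \<alpha> \<beta>))"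
  proof (rule poly_mapping_eqI)
    fix g
    have canonical: "Poly_Mapping.lookup (canonical_vec G \<phi> \<alpha> \<beta>) g
        = of_bool (g \<in> carrier G \<and> \<phi> g \<alpha> = \<beta>)" for \<alpha> \<beta>
      unfolding canonical_vec_def using finG by (subst lookup_sum_single) auto
    have "Poly_Mapping.lookup (\<Sum>(\<alpha>,\<beta>)\<in>E \<times> E. scale (c \<alpha> \<beta>) (canonical_vec G \<phi> \<alpha> \<beta>)) g
        = (\<Sum>(\<alpha>,\<beta>)\<in>E \<times> E. c \<alpha> \<beta> * of_bool (g \<in> carrier G \<and> \<phi> g \<alpha> = \<beta>))"
      by (simp add: lookup_sum case_prod_beta lookup_scale canonical)
    also have "\<dots> = of_bool (g \<in> S)"
      using c[of g] S by (cases "g \<in> carrier G") auto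
    finally show "Poly_Mapping.lookup (char_vec S) g
        = Poly_Mapping.lookup (\<Sum>(\<alpha>,\<beta>)\<in>E \<times> E. scale (c \<alpha> \<beta>) (canonical_vec G \<phi> \<alpha> \<beta>)) g"
      using finS by (simp add: char_vec_def lookup_sum_single)
  qed
  also have "\<dots> \<in> group_algebra.span {canonical_vec G \<phi> \<alpha> \<beta> | \<alpha> \<beta>. \<alpha> \<in> E \<and> \<beta> \<in> E}"
    by (intro group_algebra.span_sum)
      (clarsimp, rule group_algebra.span_scale, rule group_algebra.span_base, blast)
  finally show ?thesis .
qed

section \<open>Maximum intersecting sets and the regular normal subgroup\<close>

lemma (in group_action) stabilizer_intersecting:
  assumes "x \<in> E"
  shows "intersecting_set G E \<phi> (stabilizer G \<phi> x)"
proof -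
  have "\<phi> (s \<otimes> inv t) x = x" if "s \<in> stabilizer G \<phi> x" "t \<in> stabilizer G \<phi> x" for s t
    using stabilizer_m_closed[OF assms that(1) stabilizer_m_inv_closed[OF assms that(2)]]
    by (simp add: stabilizer_def)
  then show ?thesis
    using assms stabilizer_subset unfolding intersecting_set_def intersect_def by blast
qed

locale regular_normal_action = group_action +
  fixes N
  assumes normal: "N \<lhd> G"
    and regular: "regular_action (G\<lparr>carrier := N\<rparr>) E \<phi>"
begin

lemma group_G: "group G"
  using group_hom group_hom.axioms(1) by auto

lemma N_subset: "N \<subseteq> carrier G"
  using normal normal_imp_subgroup subgroup.subset by blast

lemma N_transitive: "x \<in> E \<Longrightarrow> y \<in> E \<Longrightarrow> \<exists>n\<in>N. \<phi> n x = y"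
  using transitive_action.unique_orbit[OF regular_action.axioms(1)[OF regular]] by simp

lemma N_fixed_point_free: "x \<in> E \<Longrightarrow> n \<in> N \<Longrightarrow> \<phi> n x = x \<Longrightarrow> n = \<one>"
  using regular_action.trivial_stabilizer[OF regular, of x]
  by (auto simp: stabilizer_def)

lemma stabilizer_projection_exists:
  assumes x: "x \<in> E" and g: "g \<in> carrier G"
  shows "\<exists>h\<in>stabilizer G \<phi> x. \<exists>n\<in>N. g = n \<otimes> h"
proof -
  interpret group G by (rule group_G)
  obtain n where n: "n \<in> N" "\<phi> n x = \<phi> g x"
    using N_transitive[OF x element_image[OF g x refl]] by blast
  have nG: "n \<in> carrier G" using n(1) N_subset by blast
  have "\<phi> (inv n \<otimes> g) x = x"
    using composition_rule[OF x inv_closed[OF nG] g] orbit_sym_aux[OF nG x n(2)] by simp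
  then have "inv n \<otimes> g \<in> stabilizer G \<phi> x"
    using nG g by (simp add: stabilizer_def)
  moreover have "g = n \<otimes> (inv n \<otimes> g)"
    using nG g by (simp add: m_assoc[symmetric])
  ultimately show ?thesis using n(1) by blast
qed

text \<open>If \<open>s \<otimes> inv t\<close> fixes \<open>m \<sqdot> x\<close> with \<open>m \<in> N\<close>, then \<open>inv m \<otimes> (s \<otimes> inv t) \<otimes> m\<close> fixes \<open>x\<close>. It lies
  in the same coset of \<open>N\<close> as \<open>h \<otimes> inv k\<close>, which also fixes \<open>x\<close>, and \<open>N\<close> has trivial
  stabilizers.\<close>

lemma intersect_conjugate_projection:
  assumes x: "x \<in> E"
    and h: "h \<in> stabilizer G \<phi> x" and k: "k \<in> stabilizer G \<phi> x"
    and n: "n \<in> N" and n': "n' \<in> N"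
    and meet: "intersect G E \<phi> (n \<otimes> h) (n' \<otimes> k)"
  shows "\<exists>m\<in>carrier G. inv m \<otimes> (n \<otimes> h \<otimes> inv (n' \<otimes> k)) \<otimes> m = h \<otimes> inv k"
proof -
  interpret group G by (rule group_G)
  interpret normal N G by (rule normal)
  have G: "h \<in> carrier G" "k \<in> carrier G" "n \<in> carrier G" "n' \<in> carrier G"
    using h k n n' N_subset stabilizer_subset by blast+
  define z where "z = h \<otimes> inv k"
  have z: "z \<in> stabilizer G \<phi> x"
    unfolding z_def by (intro stabilizer_m_closed[OF x] stabilizer_m_inv_closed[OF x] h k)
  have zG: "z \<in> carrier G" using z stabilizer_subset by blast
  define p where "p = n \<otimes> h \<otimes> inv (n' \<otimes> k)"
  have pG: "p \<in> carrier G" using G by (simp add: p_def)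
  obtain y where y: "y \<in> E" "\<phi> p y = y"
    using meet unfolding intersect_def p_def by blast
  obtain m where m: "m \<in> N" "\<phi> m x = y" using N_transitive[OF x y(1)] by blast
  have mG: "m \<in> carrier G" using m N_subset by blast
  define q where "q = inv m \<otimes> p \<otimes> m"
  have qG: "q \<in> carrier G" using mG pG by (simp add: q_def)
  have "\<phi> q x = x"
    using x y m(2) mG pG orbit_sym_aux[OF mG x m(2)] by (simp add: q_def composition_rule)
  then have "q \<in> stabilizer G \<phi> x" using qG by (simp add: stabilizer_def)
  then have "q \<otimes> inv z \<in> stabilizer G \<phi> x"
    by (intro stabilizer_m_closed[OF x] stabilizer_m_inv_closed[OF x] z)
  then have fix_qz: "\<phi> (q \<otimes> inv z) x = x" by (simp add: stabilizer_def)
  have "q \<otimes> inv z = inv m \<otimes> n \<otimes> (z \<otimes> (inv n' \<otimes> m) \<otimes> inv z)"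
    using G mG by (simp add: q_def p_def z_def inv_mult_group m_assoc)
  also have "\<dots> \<in> N"
    using m(1) n n' zG by (intro m_closed inv_op_closed2) auto
  finally have "q \<otimes> inv z = \<one>"
    using N_fixed_point_free[OF x _ fix_qz] by blast
  then have "q = z"
    using qG zG by (metis inv_closed inv_inv inv_equality)
  then show ?thesis
    using mG unfolding q_def p_def z_def by blast
qed

text \<open>Maximality enters only through \<open>card S \<ge> card H\<close>, which makes the injective projection of \<open>S\<close>
  to the stabilizer \<open>H\<close> a bijection, along which quotients keep their conjugacy class.\<close>

lemma sum_class_fun_eq_stabilizer:
  fixes r :: "'a \<Rightarrow> complex"
  assumes finG: "finite (carrier G)" and x: "x \<in> E"
    and invariant: "\<And>m g. m \<in> carrier G \<Longrightarrow> g \<in> carrier G \<Longrightarrow> r (inv m \<otimes> g \<otimes> m) = r g"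
    and max: "maximum_intersecting_set G E \<phi> S"
  shows "(\<Sum>t\<in>S. \<Sum>s\<in>S. r (t \<otimes> inv s))
    = (\<Sum>h\<in>stabilizer G \<phi> x. \<Sum>k\<in>stabilizer G \<phi> x. r (h \<otimes> inv k))"
proof -
  interpret group G by (rule group_G)
  let ?H = "stabilizer G \<phi> x"
  have S: "S \<subseteq> carrier G" and meet: "\<And>s t. s \<in> S \<Longrightarrow> t \<in> S \<Longrightarrow> intersect G E \<phi> s t"
    and card_le: "card ?H \<le> card S"
    using max stabilizer_intersecting[OF x]
    unfolding maximum_intersecting_set_def intersecting_set_def by blast+
  have finH: "finite ?H" using finG stabilizer_subset by (rule rev_finite_subset)
  obtain \<pi> where \<pi>: "\<And>g. g \<in> carrier G \<Longrightarrow> \<pi> g \<in> ?H"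
      "\<And>g. g \<in> carrier G \<Longrightarrow> \<exists>n\<in>N. g = n \<otimes> \<pi> g"
    using stabilizer_projection_exists[OF x] by metis
  have conj: "\<exists>m\<in>carrier G. inv m \<otimes> (s \<otimes> inv t) \<otimes> m = \<pi> s \<otimes> inv (\<pi> t)"
    if st: "s \<in> S" "t \<in> S" for s t
  proof -
    have "s \<in> carrier G" "t \<in> carrier G" using st S by auto
    then obtain n n' where "n \<in> N" "n' \<in> N" "s = n \<otimes> \<pi> s" "t = n' \<otimes> \<pi> t"
      using \<pi>(2) by blast
    then show ?thesis
      using intersect_conjugate_projection[OF x \<pi>(1)[of s] \<pi>(1)[of t], of n n'] meet[OF st]
        \<open>s \<in> carrier G\<close> \<open>t \<in> carrier G\<close> by simp
  qed
  have "inj_on \<pi> S"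
  proof (rule inj_onI)
    fix s t assume st: "s \<in> S" "t \<in> S" "\<pi> s = \<pi> t"
    have G: "s \<in> carrier G" "t \<in> carrier G" "\<pi> t \<in> carrier G"
      using st S \<pi>(1) stabilizer_subset by auto
    obtain m where m: "m \<in> carrier G" "inv m \<otimes> (s \<otimes> inv t) \<otimes> m = \<one>"
      using conj[OF st(1,2)] st(3) G by auto
    have "s \<otimes> inv t = m \<otimes> (inv m \<otimes> (s \<otimes> inv t) \<otimes> m) \<otimes> inv m"
      using G m(1) by (simp add: m_assoc[symmetric]) (simp add: m_assoc)
    then have "s \<otimes> inv t = \<one>" using m by simp
    then show "s = t" using G by (metis inv_closed inv_inv inv_equality)
  qed
  moreover have "\<pi> ` S \<subseteq> ?H" using \<pi>(1) S by blast
  ultimately have bij: "bij_betw \<pi> S ?H"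
    using card_le finH by (metis bij_betw_def card_image card_seteq)
  have "r (t \<otimes> inv s) = r (\<pi> t \<otimes> inv (\<pi> s))" if "s \<in> S" "t \<in> S" for s t
    using conj[OF that(2,1)] invariant[of _ "t \<otimes> inv s"] S that
    by (metis inv_closed m_closed subsetD)
  then have "(\<Sum>t\<in>S. \<Sum>s\<in>S. r (t \<otimes> inv s)) = (\<Sum>t\<in>S. \<Sum>s\<in>S. r (\<pi> t \<otimes> inv (\<pi> s)))"
    by simp
  also have "\<dots> = (\<Sum>t\<in>S. \<Sum>k\<in>?H. r (\<pi> t \<otimes> inv k))"
    by (intro sum.cong refl sum.reindex_bij_betw[OF bij])
  also have "\<dots> = (\<Sum>h\<in>?H. \<Sum>k\<in>?H. r (h \<otimes> inv k))"
    by (rule sum.reindex_bij_betw[OF bij])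
  finally show ?thesis .
qed

end

theorem theorem1p6:
  fixes G :: "('a, 'm) monoid_scheme" and \<Omega> :: "'b set"
    and \<phi> :: "'a \<Rightarrow> 'b \<Rightarrow> 'b" and N :: "'a set"
  assumes "finite (carrier G)"
    and "transitive_action G \<Omega> \<phi>"
    and "N \<lhd> G"
    and "regular_action (G\<lparr>carrier := N\<rparr>) \<Omega> \<phi>"
  shows "EKR_module_property G \<Omega> \<phi>"
  unfolding EKR_module_property_def
proof (intro allI impI)
  fix S assume max: "maximum_intersecting_set G \<Omega> \<phi> S"
  interpret transitive_action G \<Omega> \<phi> by (rule assms(2))
  interpret regular_normal_action G \<Omega> \<phi> N
    using assms(3,4) by (intro regular_normal_action.intro regular_normal_action_axioms.intro
        group_action_axioms)
  have S: "S \<subseteq> carrier G"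
    using max by (simp add: maximum_intersecting_set_def intersecting_set_def)
  show "char_vec S \<in> group_algebra.span {canonical_vec G \<phi> \<alpha> \<beta> | \<alpha> \<beta>. \<alpha> \<in> \<Omega> \<and> \<beta> \<in> \<Omega>}"
  proof (cases "\<Omega> = {}")
    case True
    \<comment> \<open>Without points no element intersects even itself.\<close>
    with max have "S = {}"
      unfolding maximum_intersecting_set_def intersecting_set_def intersect_def by blast
    then show ?thesis by (simp add: char_vec_def group_algebra.span_zero)
  next
    case False
    then obtain x where x: "x \<in> \<Omega>" by blast
    let ?H = "stabilizer G \<phi> x"
    have "\<Omega> \<subseteq> (\<lambda>g. \<phi> g x) ` carrier G"
      using unique_orbit[OF x] by blast
    then have fin\<Omega>: "finite \<Omega>"
      using assms(1) by (meson finite_imageI finite_subset)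
    obtain r :: "'a \<Rightarrow> complex" where
      in_ideal: "point_image_fun G \<Omega> \<phi> (\<lambda>g. of_bool (g = \<one>\<^bsub>G\<^esub>) - r g)" and
      orth: "\<And>f. point_image_fun G \<Omega> \<phi> f \<Longrightarrow> hip (carrier G) r f = 0" and
      invariant: "\<And>m g. m \<in> carrier G \<Longrightarrow> g \<in> carrier G \<Longrightarrow>
        r (inv\<^bsub>G\<^esub> m \<otimes>\<^bsub>G\<^esub> g \<otimes>\<^bsub>G\<^esub> m) = r g"
      using orthogonal_class_function_exists[OF assms(1) fin\<Omega>] by metis
    have mem_iff: "point_image_fun G \<Omega> \<phi> (\<lambda>g. of_bool (g \<in> T)) \<longleftrightarrow>
        (\<Sum>t\<in>T. \<Sum>s\<in>T. r (t \<otimes>\<^bsub>G\<^esub> inv\<^bsub>G\<^esub> s)) = 0" if "T \<subseteq> carrier G" for T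
      using in_ideal orth that by (rule indicator_mem_ideal_iff[OF assms(1)])
    have "point_image_fun G \<Omega> \<phi> (\<lambda>g. of_bool (g \<in> ?H))"
      using point_image_fun_canonical[OF fin\<Omega> x, of G \<phi> x]
      by (subst point_image_fun_cong[where f' = "\<lambda>g. of_bool (\<phi> g x = x)"])
        (simp_all add: stabilizer_def)
    then have "point_image_fun G \<Omega> \<phi> (\<lambda>g. of_bool (g \<in> S))"
      using mem_iff[OF S] mem_iff[OF stabilizer_subset]
        sum_class_fun_eq_stabilizer[OF assms(1) x invariant max] by simp
    then show ?thesis
      by (rule char_vec_in_span_canonical[OF assms(1) fin\<Omega> S])
  qed
qed

end
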